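(* Let $G$ be a nilpotent, locally compact Hausdorff group, let $1<p<\infty$, and let $\omega:G\to(0,\infty)$ be a diagonally bounded weight. If $L^p_{\omega}(G)$ is closed under convolution, i.e. $L^p_{\omega}(G)\star L^p_{\omega}(G)\subset L^p_{\omega}(G)$, then $G$ is compact.
   Context: $G$ carries a left Haar measure $\mu$. $G$ is nilpotent (as an abstract group) if its upper central series $\{e\}=Z_0\triangleleft Z_1\triangleleft\cdots$, defined by $Z_0=\{e\}$ and $Z_n=\{x\in G:\ [x,y]\in Z_{n-1}\text{ for all }y\in G\}$, satisfies $Z_N=G$ for some $N\in\mathbb{N}$. A weight on $G$ is a measurable function $\omega:G\to(0,\infty)$ which is submultiplicative: $\omega(xy)\le\omega(x)\,\omega(y)$ for all $x,y\in G$. A weight $\omega$ is diagonally bounded if there is $M>0$ such that $\omega(x)\,\omega(x^{-1})<M$ for all $x\in G$. $L^p_{\omega}(G)$ is the Banach space of (a.e.-equivalence classes of) measurable functions $f:G\to\mathbb{C}$ with $\int_G |f\omega|^p\,d\mu<\infty$, with norm $\|f\|_{p,\omega}=\|f\omega\|_{L^p(\mu)}$. The convolution of measurable functions $f,g:G\to\mathbb{C}$ is $(f\star g)(x)=\int_G f(y)\,g(y^{-1}x)\,d\mu(y)$. "$L^p_\omega(G)$ is closed under convolution" means that for all $f,g\in L^p_\omega(G)$ the convolution $f\star g$ is defined almost everywhere and belongs to $L^p_\omega(G)$. *)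

theory Defs
  imports "HOL-Analysis.Analysis"
begin

text \<open>
  Topological groups are types of class \<open>topological_group_add\<close>. This class does not assume
  commutativity: \<open>x + y\<close> is the product \<open>xy\<close>, \<open>- x\<close> is the inverse and \<open>0\<close> is the identity.
\<close>

text \<open>\<open>x + y - x - y\<close> is the commutator \<open>x y x\<^sup>-\<^sup>1 y\<^sup>-\<^sup>1\<close>.\<close>

primrec upper_central :: "nat \<Rightarrow> 'a::group_add set" where
  "upper_central 0 = {0}"
| "upper_central (Suc n) = {x. \<forall>y. x + y - x - y \<in> upper_central n}"

definition nilpotent_group :: "'a::group_add itself \<Rightarrow> bool" where
  "nilpotent_group _ \<longleftrightarrow> (\<exists>N. upper_central N = (UNIV :: 'a set))"

text \<open>
  A left Haar measure is a nonzero left-invariant Radon measure. Only \<open>sets borel \<subseteq> sets \<mu>\<close> is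
  required, so \<open>\<mu>\<close> may live on the Borel sets, on their completion, or on all Haar measurable
  (Caratheodory measurable) sets; ``measurable'' below always refers to \<open>sets \<mu>\<close>.
  By outer regularity every set of finite measure in \<open>sets \<mu>\<close> is Borel up to a null set.
\<close>

definition left_haar_measure :: "'a::{topological_group_add, t2_space} measure \<Rightarrow> bool" where
  "left_haar_measure \<mu> \<longleftrightarrow>
     space \<mu> = UNIV \<and>
     sets borel \<subseteq> sets \<mu> \<and>
     emeasure \<mu> UNIV \<noteq> 0 \<and>
     (\<forall>a. \<forall>A\<in>sets \<mu>. (+) a ` A \<in> sets \<mu> \<and> emeasure \<mu> ((+) a ` A) = emeasure \<mu> A) \<and>
     (\<forall>K. compact K \<longrightarrow> emeasure \<mu> K < \<infinity>) \<and>
     (\<forall>A\<in>sets \<mu>. emeasure \<mu> A = (INF U\<in>{U. open U \<and> A \<subseteq> U}. emeasure \<mu> U)) \<and>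
     (\<forall>U. open U \<longrightarrow> emeasure \<mu> U = (SUP K\<in>{K. compact K \<and> K \<subseteq> U}. emeasure \<mu> K))"

definition weight :: "'a::group_add measure \<Rightarrow> ('a \<Rightarrow> real) \<Rightarrow> bool" where
  "weight \<mu> \<omega> \<longleftrightarrow>
     \<omega> \<in> borel_measurable \<mu> \<and> (\<forall>x. 0 < \<omega> x) \<and> (\<forall>x y. \<omega> (x + y) \<le> \<omega> x * \<omega> y)"

definition diagonally_bounded :: "('a::group_add \<Rightarrow> real) \<Rightarrow> bool" where
  "diagonally_bounded \<omega> \<longleftrightarrow> (\<exists>M>0. \<forall>x. \<omega> x * \<omega> (- x) < M)"

text \<open>The set of representatives of the elements of \<open>L\<^sup>p\<^sub>\<omega>(G)\<close>.\<close>

definition weighted_Lp :: "'a measure \<Rightarrow> real \<Rightarrow> ('a \<Rightarrow> real) \<Rightarrow> ('a \<Rightarrow> complex) set" where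
  "weighted_Lp \<mu> p \<omega> =
     {f \<in> borel_measurable \<mu>.
        (\<integral>\<^sup>+ x. ennreal (norm (f x * complex_of_real (\<omega> x)) powr p) \<partial>\<mu>) < \<infinity>}"

definition convolution ::
    "'a::group_add measure \<Rightarrow> ('a \<Rightarrow> complex) \<Rightarrow> ('a \<Rightarrow> complex) \<Rightarrow> 'a \<Rightarrow> complex" where
  "convolution \<mu> f g x = (\<integral> y. f y * g (- y + x) \<partial>\<mu>)"

text \<open>
  Since Bochner integrals of non-integrable functions are \<open>0\<close>, the existence of the convolution
  is stated separately. It only determines an a.e.-equivalence class, so membership in the
  space means that it agrees a.e. with some member of \<open>weighted_Lp\<close>.
\<close>

definition closed_under_convolution ::
    "'a::group_add measure \<Rightarrow> ('a \<Rightarrow> complex) set \<Rightarrow> bool" where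
  "closed_under_convolution \<mu> L \<longleftrightarrow>
     (\<forall>f\<in>L. \<forall>g\<in>L.
        (AE x in \<mu>. integrable \<mu> (\<lambda>y. f y * g (- y + x))) \<and>
        (\<exists>h\<in>L. AE x in \<mu>. convolution \<mu> f g x = h x))"

end

theory Submission
  imports Defs "HOL-Library.Set_Algebras" "HOL-Real_Asymp.Real_Asymp"
begin

text \<open>
  Let \<open>V\<close> be a compact symmetric neighbourhood of the identity. The convolution of the indicators
  of \<open>V\<close> and \<open>V\<^bsup>n+2\<^esup>\<close> equals \<open>\<mu>(V)\<close> on \<open>V\<^bsup>n+1\<^esup>\<close>. Finitely generated nilpotent groups
  have polynomial growth, hence so does \<open>\<mu>(V\<^sup>n)\<close>, and some \<open>n\<close> satisfies
  \<open>\<mu>(V\<^bsup>n+2\<^esup>) \<le> 2\<mu>(V\<^bsup>n+1\<^esup>)\<close>. For this \<open>n\<close>, convolving the \<open>L\<^sup>p\<close>-normalised indicators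
  of \<open>V\<close> and \<open>V\<^bsup>n+2\<^esup>\<close> gives a function whose \<open>L\<^sup>p\<close> norm is at least of order \<open>\<mu>(V)\<^bsup>1-1/p\<^esup>\<close>.
  If \<open>G\<close> is not compact, then \<open>\<mu>(V)\<close> can be made arbitrarily large, and superposing these examples gives two functions in the space whose
  convolution is not in it. Dividing the functions by \<open>\<omega>\<close> reduces the weighted case to the
  unweighted one because \<open>\<omega>\<close> is diagonally bounded.
\<close>

section \<open>Growth of nilpotent groups\<close>

primrec set_power :: "'a::monoid_add set \<Rightarrow> nat \<Rightarrow> 'a set" where
  "set_power A 0 = {0}"
| "set_power A (Suc n) = set_power A n + A"

lemma singleton_zero_plus [simp]: "{0} + A = (A :: 'a::monoid_add set)"
  by (auto simp: set_plus_def)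

lemma set_power_add:
  assumes "x \<in> set_power A m" and "y \<in> set_power A n"
  shows "x + y \<in> set_power A (m + n)"
  using assms(2)
proof (induction n arbitrary: y)
  case 0
  then show ?case using assms(1) by simp
next
  case (Suc n)
  then obtain z a where y: "y = z + a" and z: "z \<in> set_power A n" and a: "a \<in> A"
    by (auto elim: set_plus_elim)
  have "(x + z) + a \<in> set_power A (m + n) + A"
    using Suc.IH[OF z] a by (rule set_plus_intro)
  then show ?case by (simp add: y add.assoc)
qed

lemma set_power_mono_exponent:
  assumes "0 \<in> A" and "m \<le> n"
  shows "set_power A m \<subseteq> set_power A n"
  using assms(2)
proof (induction rule: dec_induct)
  case (step k)
  have "x \<in> set_power A k + A" if "x \<in> set_power A k" for x
    using set_plus_intro[OF that assms(1)] by simp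
  with step show ?case by auto
qed simp

lemma set_power_mono: "A \<subseteq> B \<Longrightarrow> set_power A n \<subseteq> set_power B n"
  by (induction n) (auto dest: set_plus_mono2[of _ _ A B])

lemma finite_set_power: "finite A \<Longrightarrow> finite (set_power A n)"
  by (induction n) (auto intro: finite_set_plus)

section \<open>Commutators, collection of letters and polynomial word growth\<close>

lemma zero_in_upper_central [simp]: "0 \<in> upper_central n"
  by (induction n) auto

text \<open>The identity [-x, y] = -[x, -x + y] reduces the claim to the level below, where the
  induction hypothesis removes the outer inverse.\<close>

lemma upper_central_uminus:
  "(x :: 'a::group_add) \<in> upper_central n \<Longrightarrow> - x \<in> upper_central n"
proof (induction n arbitrary: x)
  case (Suc n)
  have eq: "- x + y - (- x) - y = - (x + (- x + y) - x - (- x + y))" for y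
    by (simp add: minus_add algebra_simps diff_conv_add_uminus del: add_uminus_conv_diff)
  have *: "- (x + (- x + y) - x - (- x + y)) \<in> upper_central n" for y
    using Suc.prems unfolding upper_central.simps mem_Collect_eq by (intro Suc.IH) (rule spec)
  have "- x + y - (- x) - y \<in> upper_central n" for y
    unfolding eq by (rule *)
  then show ?case
    by simp
qed simp

text \<open>The recursive definition covers only the left entry of a commutator. The right entry
  follows from [x, y] = -[y, x] and closure under inverses.\<close>

lemma commutator_in_upper_central:
  fixes x y :: "'a::group_add"
  assumes "x \<in> upper_central (Suc n) \<or> y \<in> upper_central (Suc n)"
  shows "x + y - x - y \<in> upper_central n"
proof -
  have "x + y - x - y = - (y + x - y - x)"
    by (simp add: minus_add diff_conv_add_uminus add.assoc del: add_uminus_conv_diff)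
  moreover have "- (y + x - y - x) \<in> upper_central n" if "y \<in> upper_central (Suc n)"
    using that by (intro upper_central_uminus) auto
  moreover have "x + y - x - y \<in> upper_central n" if "x \<in> upper_central (Suc n)"
    using that by simp
  ultimately show ?thesis
    using assms by metis
qed

text \<open>\<open>B\<close> holds elements whose mutual commutators already lie in
  \<open>A\<close>. If all commutators of \<open>A\<close> are adjoined, a new one must have an
  entry in \<open>A - B\<close>, so it lies one level lower in the central series, and the induction
  continues with the enlarged set and \<open>A\<close> in place of \<open>A\<close> and
  \<open>B\<close>. At level 0 only the identity can lie outside \<open>B\<close>, and its
  commutators are trivial.\<close>

lemma commutator_closure_extend:
  fixes A B :: "'a::group_add set"
  assumes "finite A" and "B \<subseteq> A" and "A - B \<subseteq> upper_central k"
    and "\<And>a b. a \<in> B \<Longrightarrow> b \<in> B \<Longrightarrow> a + b - a - b \<in> A"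
  shows "\<exists>Y. finite Y \<and> A \<subseteq> Y \<and> 0 \<in> Y \<and> (\<forall>a\<in>Y. \<forall>b\<in>Y. a + b - a - b \<in> Y)"
  using assms
proof (induction k arbitrary: A B)
  case 0
  have "a + b - a - b \<in> insert 0 A" if "a \<in> insert 0 A" "b \<in> insert 0 A" for a b
  proof -
    have "a = 0 \<or> a \<in> B" "b = 0 \<or> b \<in> B"
      using that 0 by auto
    then show ?thesis using 0(4) by auto
  qed
  with 0(1) show ?case
    by (intro exI[of _ "insert 0 A"]) blast
next
  case (Suc k)
  define A' where "A' = A \<union> (\<lambda>(a, b). a + b - a - b) ` (A \<times> A)"
  have "A' - A \<subseteq> upper_central k"
  proof
    fix c assume c: "c \<in> A' - A"
    then obtain a b where ab: "a \<in> A" "b \<in> A" "c = a + b - a - b"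
      by (auto simp: A'_def)
    with c Suc.prems have "a \<in> upper_central (Suc k) \<or> b \<in> upper_central (Suc k)"
      by (metis DiffE DiffI subsetD)
    then show "c \<in> upper_central k"
      unfolding ab(3) by (rule commutator_in_upper_central)
  qed
  moreover have "finite A'" "A \<subseteq> A'"
    using Suc.prems(1) by (auto simp: A'_def)
  ultimately have "\<exists>Y. finite Y \<and> A' \<subseteq> Y \<and> 0 \<in> Y \<and> (\<forall>a\<in>Y. \<forall>b\<in>Y. a + b - a - b \<in> Y)"
    by (intro Suc.IH[of A' A]) (auto simp: A'_def)
  then show ?case using \<open>A \<subseteq> A'\<close> by (meson order_trans)
qed

text \<open>Write f for conjugation by x. Since f y = [x, y] + y and f is a homomorphism, f^(a+1) y
  = f^a [x, y] + f^a y. The commutator lies one level lower and is handled by the induction on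
  \<open>r\<close>, the other summand by the induction on \<open>a\<close>. At level 0 the element
  is the identity, which still counts as one letter; hence the identity has to belong to
  \<open>S\<close>.\<close>

lemma funpow_conj_in_set_power:
  fixes x :: "'a::group_add"
  assumes "0 \<in> S" and "\<And>y. y \<in> S \<Longrightarrow> x + y - x - y \<in> S"
    and "y \<in> S" and "y \<in> upper_central r"
  shows "((\<lambda>z. x + z - x) ^^ a) y \<in> set_power S ((a + 1) ^ r)"
  using assms(3,4)
proof (induction r arbitrary: y a)
  case 0
  have "((\<lambda>z. x + z - x) ^^ a) 0 = 0"
    by (induction a) auto
  moreover have "0 \<in> set_power S (Suc 0)"
    using assms(1) by simp
  ultimately show ?case using 0 by (simp del: set_power.simps)
next
  case (Suc r)
  note outer_IH = Suc.IH and y = Suc.prems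
  show ?case
  proof (induction a)
    case 0
    have "y \<in> set_power S (Suc 0)"
      using y(1) by simp
    then show ?case by (simp del: set_power.simps)
  next
    case (Suc a)
    let ?f = "\<lambda>z. x + z - x"
    let ?c = "x + y - x - y"
    have hom: "(?f ^^ n) (u + v) = (?f ^^ n) u + (?f ^^ n) v" for n u v
      by (induction n) (simp_all add: diff_conv_add_uminus add.assoc del: add_uminus_conv_diff)
    have "(?f ^^ Suc a) y = (?f ^^ a) (?c + y)"
      by (simp only: funpow_Suc_right o_apply diff_add_cancel)
    also have "\<dots> = (?f ^^ a) ?c + (?f ^^ a) y"
      by (rule hom)
    also have "\<dots> \<in> set_power S ((a + 1) ^ r + (a + 1) ^ Suc r)"
    proof (rule set_power_add)
      show "(?f ^^ a) ?c \<in> set_power S ((a + 1) ^ r)"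
        using y by (intro outer_IH assms(2) commutator_in_upper_central disjI2)
      show "(?f ^^ a) y \<in> set_power S ((a + 1) ^ Suc r)"
        using Suc.IH .
    qed
    also have "\<dots> \<subseteq> set_power S ((Suc a + 1) ^ Suc r)"
    proof (rule set_power_mono_exponent[OF assms(1)])
      have "(a + 1) ^ r + (a + 1) ^ Suc r = (a + 1) ^ r * (a + 2)"
        by simp
      also have "\<dots> \<le> (a + 2) ^ r * (a + 2)"
        by (intro mult_right_mono power_mono) auto
      finally show "(a + 1) ^ r + (a + 1) ^ Suc r \<le> (Suc a + 1) ^ Suc r"
        by (simp add: mult.commute)
    qed
    finally show ?case .
  qed
qed

text \<open>Move all occurrences of \<open>x\<close> to the right: passing \<open>k\<close> of them conjugates a letter \<open>s\<close> by
  \<open>x\<^sup>k\<close>, which costs only polynomially many letters of \<open>T\<close>.\<close>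

lemma set_power_insert_subset:
  fixes x :: "'a::group_add"
  assumes "0 \<in> T" and "\<And>y. y \<in> T \<Longrightarrow> x + y - x - y \<in> T" and "T \<subseteq> upper_central r"
  shows "set_power (insert x T) n
    \<subseteq> (\<lambda>(k, u). u + ((+) x ^^ k) 0) ` ({..n} \<times> set_power T (n * (n + 1) ^ r))"
proof (induction n)
  case 0
  then show ?case by auto
next
  case (Suc n)
  let ?f = "\<lambda>z. x + z - x" and ?X = "\<lambda>k. ((+) x ^^ k) 0"
  have X_right: "?X k + x = ?X (Suc k)" for k
    by (induction k) (auto simp: add.assoc)
  have X_pass: "?X k + s = (?f ^^ k) s + ?X k" for k s
  proof (induction k)
    case (Suc k)
    have "?X (Suc k) + s = x + (?X k + s)" by (simp add: add.assoc)
    also have "\<dots> = x + ((?f ^^ k) s + ?X k)" by (simp only: Suc)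
    also have "\<dots> = (?f ^^ Suc k) s + ?X (Suc k)"
      by (simp add: diff_conv_add_uminus add.assoc del: add_uminus_conv_diff)
    finally show ?case .
  qed simp
  \<comment> \<open>Appending a letter of \<open>T\<close> means conjugating it by a power of
    \<open>x\<close> with exponent at most n, which adds at most (n + 1)^r letters to the n * (n +
    1)^r present so far.\<close>
  have le: "n * (n + 1) ^ r + (n + 1) ^ r \<le> Suc n * (Suc n + 1) ^ r"
  proof -
    have "n * (n + 1) ^ r + (n + 1) ^ r = Suc n * (n + 1) ^ r" by simp
    also have "\<dots> \<le> Suc n * (Suc n + 1) ^ r"
      by (intro mult_left_mono power_mono) auto
    finally show ?thesis .
  qed
  show ?case
  proof
    fix w assume "w \<in> set_power (insert x T) (Suc n)"
    then obtain v s where w: "w = v + s" and v: "v \<in> set_power (insert x T) n"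
      and s: "s \<in> insert x T"
      by (auto elim: set_plus_elim)
    from v Suc obtain k u where k: "k \<le> n" and u: "u \<in> set_power T (n * (n + 1) ^ r)"
      and v: "v = u + ?X k"
      by auto
    show "w \<in> (\<lambda>(k, u). u + ?X k) ` ({..Suc n} \<times> set_power T (Suc n * (Suc n + 1) ^ r))"
    proof (cases "s = x")
      case True
      have "w = u + ?X (Suc k)"
        unfolding w v True add.assoc by (simp only: X_right)
      moreover have "u \<in> set_power T (Suc n * (Suc n + 1) ^ r)"
        using le by (intro subsetD[OF set_power_mono_exponent[OF assms(1)] u]) linarith
      ultimately show ?thesis
        using k by (intro image_eqI[of _ _ "(Suc k, u)"]) auto
    next
      case False
      with s have s: "s \<in> T" by simp
      have "(?f ^^ k) s \<in> set_power T ((k + 1) ^ r)"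
        using assms s by (intro funpow_conj_in_set_power) auto
      also have "\<dots> \<subseteq> set_power T ((n + 1) ^ r)"
        using k by (intro set_power_mono_exponent assms(1) power_mono) auto
      finally have "u + (?f ^^ k) s \<in> set_power T (n * (n + 1) ^ r + (n + 1) ^ r)"
        by (rule set_power_add[OF u])
      also have "\<dots> \<subseteq> set_power T (Suc n * (Suc n + 1) ^ r)"
        by (rule set_power_mono_exponent[OF assms(1) le])
      finally have "u + (?f ^^ k) s \<in> set_power T (Suc n * (Suc n + 1) ^ r)" .
      moreover have "w = (u + (?f ^^ k) s) + ?X k"
        unfolding w v add.assoc by (simp only: X_pass)
      ultimately show ?thesis
        using k by (intro image_eqI[of _ _ "(k, u + (?f ^^ k) s)"]) auto
    qed
  qed
qed

text \<open>Induction on the number of letters. The removed letter \<open>x\<close> is one from the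
  highest level of the central series that \<open>S\<close> reaches. Words are then sorted with the
  powers of \<open>x\<close> on the right: there are n + 1 possible exponents, and the remaining
  word in the other letters has polynomial length, so the induction hypothesis counts it.\<close>

lemma polynomial_growth_commutator_closed:
  fixes S :: "'a::group_add set"
  assumes "finite S" and "0 \<in> S" and "\<And>a b. a \<in> S \<Longrightarrow> b \<in> S \<Longrightarrow> a + b - a - b \<in> S"
    and "S \<subseteq> upper_central N"
  shows "\<exists>d. \<forall>n. card (set_power S n) \<le> (n + 1) ^ d"
  using assms
proof (induction "card S" arbitrary: S rule: less_induct)
  case less
  show ?case
  proof (cases "S = {0}")
    case True
    have "set_power {0 :: 'a} n = {0}" for n
      by (induction n) (auto simp: set_plus_def)
    with True show ?thesis
      by (intro exI[of _ 0]) simp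
  next
    case False
    define r where "r = (LEAST r. S \<subseteq> upper_central r)"
    have Sr: "S \<subseteq> upper_central r"
      unfolding r_def using less.prems(4) by (rule LeastI)
    with False less.prems(2) have "r \<noteq> 0"
      by (auto intro: Nat.gr0I)
    then obtain r' where r': "r = Suc r'"
      by (cases r) auto
    then have "\<not> S \<subseteq> upper_central r'"
      using not_less_Least[of r' "\<lambda>r. S \<subseteq> upper_central r"] by (simp add: r_def)
    then obtain x where x: "x \<in> S" "x \<notin> upper_central r'"
      by auto
    define T where "T = S - {x}"
    have ST: "S = insert x T" using x by (auto simp: T_def)
    \<comment> \<open>Commutators of elements of \<open>S\<close> drop to level \<open>r'\<close>,
      which does not contain \<open>x\<close>. Removing \<open>x\<close> therefore preserves closure
      under commutators, and commutators with \<open>x\<close> itself also land in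
      \<open>T\<close>.\<close>
    have T: "a + b - a - b \<in> T" if "a \<in> S" "b \<in> S" for a b
    proof -
      have "a + b - a - b \<in> upper_central r'"
        using that Sr r' by (intro commutator_in_upper_central) auto
      with that less.prems(3) x(2) show ?thesis by (auto simp: T_def)
    qed
    have T0: "0 \<in> T"
      using less.prems(2) x(2) by (auto simp: T_def)
    have "finite T"
      using less.prems(1) by (simp add: T_def)
    have "card T < card S"
      unfolding T_def using less.prems(1) x(1) by (rule card_Diff1_less)
    then obtain d where d: "card (set_power T n) \<le> (n + 1) ^ d" for n
      using less.hyps[of T] T T0 less.prems(4) \<open>finite T\<close> unfolding ST by blast
    have "card (set_power S n) \<le> (n + 1) ^ (1 + (r + 1) * d)" for n
    proof -
      let ?m = "n * (n + 1) ^ r"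
      have "card (set_power S n)
          \<le> card ((\<lambda>(k, u). u + ((+) x ^^ k) 0) ` ({..n} \<times> set_power T ?m))"
        unfolding ST using T T0 Sr \<open>finite T\<close>
        by (intro card_mono set_power_insert_subset finite_imageI finite_cartesian_product
            finite_set_power) (auto simp: ST)
      also have "\<dots> \<le> card ({..n} \<times> set_power T ?m)"
        using \<open>finite T\<close>
        by (intro card_image_le finite_cartesian_product finite_set_power) auto
      also have "\<dots> = (n + 1) * card (set_power T ?m)"
        by (simp add: card_cartesian_product)
      also have "\<dots> \<le> (n + 1) * (?m + 1) ^ d"
        using d by (intro mult_left_mono) auto
      also have "\<dots> \<le> (n + 1) * ((n + 1) ^ (r + 1)) ^ d"
        by (intro mult_left_mono power_mono) (auto simp: Suc_le_eq)
      also have "\<dots> = (n + 1) ^ (1 + (r + 1) * d)"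
        by (simp only: power_add power_mult power_one_right)
      finally show ?thesis .
    qed
    then show ?thesis by blast
  qed
qed

lemma nilpotent_polynomial_growth:
  fixes F :: "'a::group_add set"
  assumes "nilpotent_group TYPE('a)" and "finite F"
  shows "\<exists>d. \<forall>n. card (set_power F n) \<le> (n + 1) ^ d"
proof -
  obtain N where N: "upper_central N = (UNIV :: 'a set)"
    using assms(1) by (auto simp: nilpotent_group_def)
  \<comment> \<open>Starting from the empty set of treated elements makes the closure hypothesis
    vacuous, and at level \<open>N\<close> every element is admissible.\<close>
  obtain Y where Y: "finite Y" "F \<subseteq> Y" "0 \<in> Y" "\<And>a b. a \<in> Y \<Longrightarrow> b \<in> Y \<Longrightarrow> a + b - a - b \<in> Y"
    using commutator_closure_extend[of F "{}" N] assms(2) N by (metis empty_iff empty_subsetI subset_UNIV)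
  obtain d where d: "card (set_power Y n) \<le> (n + 1) ^ d" for n
    using polynomial_growth_commutator_closed[of Y N] Y N by auto
  have "card (set_power F n) \<le> card (set_power Y n)" for n
    using Y by (intro card_mono finite_set_power set_power_mono)
  with d show ?thesis
    using le_trans by blast
qed

section \<open>Haar measure of powers of a compact neighbourhood\<close>

lemma open_left_translation:
  fixes U :: "'a::topological_group_add set"
  assumes "open U"
  shows "open ((+) a ` U)"
proof -
  have "(+) a ` U = (\<lambda>x. - a + x) -` U"
    by (force simp: add.assoc[symmetric] image_iff)
  moreover have "continuous_on UNIV (\<lambda>x. - a + x)"
    by (intro continuous_intros)
  ultimately show ?thesis
    using assms by (simp add: open_vimage)
qed

lemma compact_left_translation:
  fixes K :: "'a::topological_group_add set"
  shows "compact K \<Longrightarrow> compact ((+) a ` K)"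
  by (intro compact_continuous_image continuous_intros)

lemma compact_uminus:
  fixes K :: "'a::topological_group_add set"
  shows "compact K \<Longrightarrow> compact (uminus ` K)"
  by (intro compact_continuous_image continuous_intros)

lemma compact_set_plus:
  fixes A B :: "'a::topological_group_add set"
  assumes "compact A" and "compact B"
  shows "compact (A + B)"
proof -
  have "A + B = (\<lambda>z. fst z + snd z) ` (A \<times> B)"
    by (force simp: set_plus_def)
  moreover have "compact ((\<lambda>z. fst z + snd z) ` (A \<times> B))"
    using assms by (intro compact_continuous_image compact_Times continuous_intros)
  ultimately show ?thesis by simp
qed

lemma compact_set_power:
  fixes A :: "'a::topological_group_add set"
  shows "compact A \<Longrightarrow> compact (set_power A n)"
  by (induction n) (auto intro: compact_set_plus)

lemma compact_subset_finite_translates: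
  fixes K U :: "'a::topological_group_add set"
  assumes "compact K" and "open U" and "0 \<in> U"
  obtains F where "finite F" and "K \<subseteq> F + U"
proof -
  have "K \<subseteq> (\<Union>x\<in>K. (+) x ` U)"
    using assms(3) by (force simp: image_iff)
  then obtain F where F: "F \<subseteq> K" "finite F" "K \<subseteq> (\<Union>x\<in>F. (+) x ` U)"
    using compactE_image[OF assms(1), of K "\<lambda>x. (+) x ` U"] open_left_translation[OF assms(2)]
    by metis
  then have "K \<subseteq> F + U"
    by (force simp: set_plus_def)
  with F that show ?thesis by blast
qed

text \<open>Transfers growth from a finite set to \<open>V\<close>: each further factor
  \<open>V\<close> is absorbed by the last one at the price of one factor \<open>F\<close>.\<close>

lemma set_power_subset_finite_plus:
  fixes V :: "'a::monoid_add set"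
  assumes "V + V \<subseteq> F + V"
  shows "set_power V (Suc n) \<subseteq> set_power F n + V"
proof (induction n)
  case 0
  then show ?case by simp
next
  case (Suc n)
  have "set_power V (Suc (Suc n)) \<subseteq> (set_power F n + V) + V"
    unfolding set_power.simps(2)[of V "Suc n"] using Suc by (rule set_plus_mono2) simp
  also have "\<dots> = set_power F n + (V + V)"
    by (simp add: add.assoc)
  also have "\<dots> \<subseteq> set_power F n + (F + V)"
    using assms by (rule set_plus_mono2[OF order_refl])
  also have "\<dots> = set_power F (Suc n) + V"
    by (simp add: add.assoc)
  finally show ?case .
qed

section \<open>Left Haar measure of compact sets and their powers\<close>

context
  fixes \<mu> :: "'a::{topological_group_add, t2_space} measure"
  assumes haar: "left_haar_measure \<mu>"
begin

lemma haar_sets_open: "open U \<Longrightarrow> U \<in> sets \<mu>"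
  using haar by (auto simp: left_haar_measure_def)

lemma haar_sets_compact: "compact K \<Longrightarrow> K \<in> sets \<mu>"
  using haar compact_imp_closed[of K] borel_closed[of K] by (auto simp: left_haar_measure_def)

lemma haar_compact_finite: "compact K \<Longrightarrow> emeasure \<mu> K < \<infinity>"
  using haar by (simp add: left_haar_measure_def)

lemma haar_fmeasurable_compact: "compact K \<Longrightarrow> K \<in> fmeasurable \<mu>"
  by (intro fmeasurableI haar_sets_compact haar_compact_finite)

lemma haar_translation:
  assumes "A \<in> sets \<mu>"
  shows "(+) a ` A \<in> sets \<mu>" and "emeasure \<mu> ((+) a ` A) = emeasure \<mu> A"
proof -
  have "\<forall>a. \<forall>A\<in>sets \<mu>. (+) a ` A \<in> sets \<mu> \<and> emeasure \<mu> ((+) a ` A) = emeasure \<mu> A"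
    using haar unfolding left_haar_measure_def by (elim conjE)
  with assms show "(+) a ` A \<in> sets \<mu>" and "emeasure \<mu> ((+) a ` A) = emeasure \<mu> A"
    by simp_all
qed

lemma haar_finite_translates:
  assumes "finite F" and "A \<in> sets \<mu>"
  shows "F + A \<in> sets \<mu>" and "emeasure \<mu> (F + A) \<le> of_nat (card F) * emeasure \<mu> A"
proof -
  have eq: "F + A = (\<Union>x\<in>F. (+) x ` A)"
    by (force simp: set_plus_def)
  show "F + A \<in> sets \<mu>"
    unfolding eq using assms haar_translation(1) by (intro sets.finite_UN) auto
  have "emeasure \<mu> (F + A) \<le> (\<Sum>x\<in>F. emeasure \<mu> ((+) x ` A))"
    unfolding eq using assms haar_translation(1) by (intro emeasure_subadditive_finite) auto
  also have "\<dots> = of_nat (card F) * emeasure \<mu> A"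
    using assms(2) by (simp add: haar_translation(2))
  finally show "emeasure \<mu> (F + A) \<le> of_nat (card F) * emeasure \<mu> A" .
qed

text \<open>Finitely many translates of \<open>U\<close> cover any compact set. If \<open>U\<close>
  were null, all compact sets would be null, and inner regularity of the whole space would make the
  measure zero.\<close>

lemma haar_open_nonzero:
  assumes "open U" and "0 \<in> U"
  shows "emeasure \<mu> U \<noteq> 0"
proof
  assume U: "emeasure \<mu> U = 0"
  have "emeasure \<mu> K = 0" if "compact K" for K
  proof -
    obtain F where F: "finite F" "K \<subseteq> F + U"
      using compact_subset_finite_translates[OF \<open>compact K\<close> assms] .
    then have "emeasure \<mu> K \<le> emeasure \<mu> (F + U)"
      by (intro emeasure_mono haar_finite_translates haar_sets_open assms)
    also have "\<dots> \<le> of_nat (card F) * emeasure \<mu> U"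
      by (intro haar_finite_translates haar_sets_open assms F)
    finally show ?thesis using U by simp
  qed
  moreover have "\<forall>U. open U \<longrightarrow> emeasure \<mu> U = (SUP K\<in>{K. compact K \<and> K \<subseteq> U}. emeasure \<mu> K)"
    using haar unfolding left_haar_measure_def by (elim conjE)
  then have "emeasure \<mu> UNIV = (SUP K\<in>{K. compact K \<and> K \<subseteq> UNIV}. emeasure \<mu> K)"
    using open_UNIV by blast
  ultimately have "emeasure \<mu> UNIV \<le> 0"
    by (metis (mono_tags, lifting) SUP_le_iff mem_Collect_eq order_refl)
  moreover have "emeasure \<mu> UNIV \<noteq> 0"
    using haar unfolding left_haar_measure_def by (elim conjE)
  ultimately show False
    by auto
qed

lemma haar_compact_nbhd_pos:
  assumes "compact V" and "0 \<in> interior V"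
  shows "0 < measure \<mu> V"
proof -
  have "emeasure \<mu> (interior V) \<noteq> 0"
    using assms(2) by (intro haar_open_nonzero) auto
  moreover have "emeasure \<mu> (interior V) \<le> emeasure \<mu> V"
    using assms by (intro emeasure_mono haar_sets_compact interior_subset)
  ultimately have "emeasure \<mu> V \<noteq> 0"
    by auto
  with haar_compact_finite[OF assms(1)] show ?thesis
    by (simp add: measure_def enn2real_positive_iff zero_less_iff_neq_zero)
qed

text \<open>Compactness of V + V gives a finite \<open>F\<close> with V + V inside F + V. Then the
  power with n + 1 factors is covered by as many translates of \<open>V\<close> as the n-th power of
  \<open>F\<close> has elements, which is polynomially many.\<close>

lemma haar_power_polynomial:
  assumes "nilpotent_group TYPE('a)" and "compact V" and "0 \<in> interior V"
  shows "\<exists>d. \<forall>n. measure \<mu> (set_power V (Suc n)) \<le> real (n + 1) ^ d * measure \<mu> V"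
proof -
  obtain F where F: "finite F" "V + V \<subseteq> F + interior V"
    using compact_subset_finite_translates[OF compact_set_plus[OF assms(2,2)] open_interior assms(3)] .
  have "F + interior V \<subseteq> F + V"
    using interior_subset by (intro set_plus_mono2) auto
  with F have VF: "V + V \<subseteq> F + V" by blast
  obtain d where d: "card (set_power F n) \<le> (n + 1) ^ d" for n
    using nilpotent_polynomial_growth[OF assms(1) F(1)] by blast
  have "measure \<mu> (set_power V (Suc n)) \<le> real (n + 1) ^ d * measure \<mu> V" for n
  proof -
    have fin: "finite (set_power F n)"
      using F(1) by (rule finite_set_power)
    have "emeasure \<mu> (set_power V (Suc n)) \<le> emeasure \<mu> (set_power F n + V)"
      using fin assms(2) VF
      by (intro emeasure_mono set_power_subset_finite_plus haar_finite_translates haar_sets_compact)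
    also have "\<dots> \<le> of_nat (card (set_power F n)) * emeasure \<mu> V"
      using fin assms(2) by (intro haar_finite_translates haar_sets_compact)
    also have "\<dots> \<le> of_nat ((n + 1) ^ d) * emeasure \<mu> V"
      by (intro mult_right_mono of_nat_mono d) simp
    finally have "emeasure \<mu> (set_power V (Suc n)) \<le> of_nat ((n + 1) ^ d) * emeasure \<mu> V" .
    \<comment> \<open>Finiteness is needed because \<open>enn2real\<close> sends infinity to 0 and
      is monotone only below infinity.\<close>
    moreover have "of_nat ((n + 1) ^ d) * emeasure \<mu> V < \<infinity>"
      using haar_compact_finite[OF assms(2)]
      by (metis ennreal_mult_less_top ennreal_of_nat_eq_real_of_nat ennreal_less_top infinity_ennreal_def)
    ultimately have "measure \<mu> (set_power V (Suc n)) \<le> enn2real (of_nat ((n + 1) ^ d) * emeasure \<mu> V)"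
      unfolding measure_def by (intro enn2real_mono) auto
    also have "\<dots> = real (n + 1) ^ d * measure \<mu> V"
      unfolding enn2real_mult measure_def by (metis enn2real_of_nat of_nat_power)
    finally show ?thesis .
  qed
  then show ?thesis by blast
qed

text \<open>If every step more than doubled the measure, growth would be exponential, against the
  polynomial bound.\<close>

lemma haar_power_doubling:
  assumes "nilpotent_group TYPE('a)" and "compact V" and "0 \<in> interior V"
  obtains n where "measure \<mu> (set_power V (Suc (Suc n))) \<le> 2 * measure \<mu> (set_power V (Suc n))"
proof (rule ccontr)
  \<comment> \<open>The sequence starts at \<open>V\<close> itself: the 0-th power is a single
    point, which may be null and would give no positive starting value.\<close>
  let ?a = "\<lambda>n. measure \<mu> (set_power V (Suc n))"
  assume "\<not> thesis"
  with that have step: "2 * ?a n < ?a (Suc n)" for n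
    by (meson not_le)
  have pos: "0 < measure \<mu> V"
    by (rule haar_compact_nbhd_pos[OF assms(2,3)])
  have exp: "2 ^ n * measure \<mu> V \<le> ?a n" for n
  proof (induction n)
    case (Suc n)
    then show ?case using step[of n] by simp
  qed simp
  obtain d where "?a n \<le> real (n + 1) ^ d * measure \<mu> V" for n
    using haar_power_polynomial[OF assms] by blast
  with exp have "2 ^ n * measure \<mu> V \<le> real (n + 1) ^ d * measure \<mu> V" for n
    by (meson order_trans)
  with pos have le: "2 ^ n \<le> real (n + 1) ^ d" for n
    by simp
  have "eventually (\<lambda>n. real (n + 1) ^ d < 2 ^ n) sequentially"
    by real_asymp
  then have "eventually (\<lambda>n :: nat. False) sequentially"
    by (rule eventually_mono) (use le in \<open>simp add: not_less[symmetric]\<close>)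
  then show False by simp
qed

text \<open>Disjoint translates of a compact neighbourhood \<open>W\<close> are packed one after
  another. If \<open>T\<close> is the union so far, T - W is compact, hence not the whole group, and
  any \<open>x\<close> outside it makes x + W disjoint from \<open>T\<close>.\<close>

lemma haar_large_compact:
  assumes "locally_compact_space (euclidean :: 'a topology)"
    and "\<not> compact (UNIV :: 'a set)"
  obtains V where "compact V" and "0 \<in> interior V" and "uminus ` V = V" and "t \<le> measure \<mu> V"
proof -
  obtain U W :: "'a set" where UW: "open U" "compact W" "0 \<in> U" "U \<subseteq> W"
    using assms(1) unfolding locally_compact_space_def
    by (metis UNIV_I compactin_euclidean_iff open_openin topspace_euclidean)
  then have W0: "0 \<in> interior W"
    by (meson interior_maximal subsetD)
  have "\<exists>T. compact T \<and> real n * measure \<mu> W \<le> measure \<mu> T" for n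
  proof (induction n)
    case 0
    show ?case by (intro exI[of _ "{}"]) simp
  next
    case (Suc n)
    then obtain T where T: "compact T" "real n * measure \<mu> W \<le> measure \<mu> T"
      by blast
    have "compact (T + uminus ` W)"
      by (intro compact_set_plus compact_uminus T UW)
    with assms(2) obtain x where x: "x \<notin> T + uminus ` W"
      by (metis UNIV_eq_I)
    have "x + w \<notin> T" if "w \<in> W" for w
    proof
      assume "x + w \<in> T"
      then have "(x + w) + (- w) \<in> T + uminus ` W"
        using that by (intro set_plus_intro) auto
      with x show False by (simp add: add.assoc)
    qed
    then have disj: "T \<inter> (+) x ` W = {}"
      by auto
    have "measure \<mu> (T \<union> (+) x ` W) = measure \<mu> T + measure \<mu> ((+) x ` W)"
      using haar_compact_finite[OF T(1)] haar_compact_finite[OF compact_left_translation[OF UW(2), of x]]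
        T(1) compact_left_translation[OF UW(2)] disj
      by (intro measure_Union haar_sets_compact) auto
    also have "measure \<mu> ((+) x ` W) = measure \<mu> W"
      using haar_translation(2)[OF haar_sets_compact[OF UW(2)]] by (simp add: measure_def)
    finally have "real (Suc n) * measure \<mu> W \<le> measure \<mu> (T \<union> (+) x ` W)"
      using T(2) by (simp add: algebra_simps)
    then show ?case
      using T(1) compact_left_translation[OF UW(2)] by (intro exI[of _ "T \<union> (+) x ` W"]) auto
  qed
  moreover obtain n where n: "t < real n * measure \<mu> W"
    using reals_Archimedean3[OF haar_compact_nbhd_pos[OF UW(2) W0]] by blast
  ultimately obtain T where T: "compact T" "t \<le> measure \<mu> T"
    by (meson less_imp_le order_trans)
  \<comment> \<open>\<open>W\<close> is included to make \<open>V\<close> a neighbourhood of the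
    identity, and the inverses to make it symmetric.\<close>
  define V where "V = (T \<union> W) \<union> uminus ` (T \<union> W)"
  show ?thesis
  proof
    show V: "compact V"
      unfolding V_def using T(1) UW(2) by (intro compact_Un compact_uminus)
    show "0 \<in> interior V"
      using W0 interior_mono[of W V] by (auto simp: V_def)
    show "uminus ` V = V"
      by (auto simp: V_def image_Un image_image)
    have "measure \<mu> T \<le> measure \<mu> V"
      using T(1) V by (intro measure_mono_fmeasurable haar_sets_compact haar_fmeasurable_compact)
        (auto simp: V_def)
    with T(2) show "t \<le> measure \<mu> V" by simp
  qed
qed

end

section \<open>Failure of closedness under convolution\<close>

text \<open>The function is the sum over k of the indicators of \<open>E k\<close>, normalised to
  integral 2^(-k), so its total integral is finite. The sets may overlap: all terms are nonnegative,
  so the k-th one alone gives the lower bound on \<open>E k\<close>.\<close>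

lemma geometric_bump:
  fixes M :: "'b measure" and E :: "nat \<Rightarrow> 'b set"
  assumes "\<And>k. E k \<in> fmeasurable M" and "\<And>k. 1 \<le> measure M (E k)"
  obtains b where "b \<in> borel_measurable M" and "\<And>x. 0 \<le> b x"
    and "\<And>k x. x \<in> E k \<Longrightarrow> (1/2) ^ k / measure M (E k) \<le> b x"
    and "(\<integral>\<^sup>+ x. ennreal (b x) \<partial>M) < \<infinity>"
proof
  define u where "u k x = (1/2) ^ k / measure M (E k) * indicat_real (E k) x" for k x
  have E: "E k \<in> sets M" for k
    using assms(1) by (rule fmeasurableD)
  have u0: "0 \<le> u k x" for k x
    by (simp add: u_def)
  \<comment> \<open>Measures at least 1 keep the k-th term below 2^(-k), so the series converges at
    every point.\<close>
  have u_le: "u k x \<le> (1/2) ^ k" for k x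
  proof -
    have "(1/2) ^ k / measure M (E k) \<le> (1/2) ^ k / 1"
      using assms(2)[of k] by (intro divide_left_mono) auto
    then show ?thesis
      by (simp add: u_def indicator_def)
  qed
  have summable_u: "summable (\<lambda>k. u k x)" for x
    using u0 u_le by (intro summable_comparison_test'[OF summable_geometric[of "1/2 :: real"]]) auto
  have [measurable]: "u k \<in> borel_measurable M" for k
    unfolding u_def using E by measurable
  show "(\<lambda>x. \<Sum>k. u k x) \<in> borel_measurable M"
    by measurable
  show "0 \<le> (\<Sum>k. u k x)" for x
    by (intro suminf_nonneg summable_u u0)
  show "(1/2) ^ k / measure M (E k) \<le> (\<Sum>k. u k x)" if "x \<in> E k" for k x
    using sum_le_suminf[OF summable_u, of "{k}" x] u0 that by (simp add: u_def)
  have int_u: "(\<integral>\<^sup>+ x. ennreal (u k x) \<partial>M) = ennreal ((1/2) ^ k)" for k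
  proof -
    have "(\<integral>\<^sup>+ x. ennreal (u k x) \<partial>M)
        = (\<integral>\<^sup>+ x. ennreal ((1/2) ^ k / measure M (E k)) * indicator (E k) x \<partial>M)"
      by (intro nn_integral_cong) (auto simp: u_def indicator_def)
    also have "\<dots> = ennreal ((1/2) ^ k / measure M (E k)) * emeasure M (E k)"
      using E by (rule nn_integral_cmult_indicator)
    also have "\<dots> = ennreal ((1/2) ^ k / measure M (E k) * measure M (E k))"
      by (subst ennreal_mult) (simp_all only: emeasure_eq_measure2[OF assms(1)], simp_all)
    finally show ?thesis
      using assms(2)[of k] by (simp add: not_le)
  qed
  have "(\<integral>\<^sup>+ x. ennreal (\<Sum>k. u k x) \<partial>M) = (\<integral>\<^sup>+ x. (\<Sum>k. ennreal (u k x)) \<partial>M)"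
    by (simp add: suminf_ennreal2 u0 summable_u)
  also have "\<dots> = (\<Sum>k. ennreal ((1/2) ^ k))"
    by (subst nn_integral_suminf) (simp_all add: int_u)
  also have "\<dots> = ennreal (\<Sum>k. (1/2) ^ k)"
    by (intro suminf_ennreal2 summable_geometric) auto
  finally show "(\<integral>\<^sup>+ x. ennreal (\<Sum>k. u k x) \<partial>M) < \<infinity>"
    by simp
qed

text \<open>Take the p-th root of an integrable bump. Dividing it by \<omega> cancels the weight in
  the norm, which leaves the integral of the bump.\<close>

lemma weighted_Lp_bump:
  fixes E :: "nat \<Rightarrow> 'a::group_add set"
  assumes "1 < p" and "weight \<mu> \<omega>"
    and "\<And>k. E k \<in> fmeasurable \<mu>" and "\<And>k. 1 \<le> measure \<mu> (E k)"
  obtains \<phi> where "(\<lambda>x. complex_of_real (\<phi> x / \<omega> x)) \<in> weighted_Lp \<mu> p \<omega>"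
    and "\<And>x. 0 \<le> \<phi> x"
    and "\<And>k x. x \<in> E k \<Longrightarrow> ((1/2) ^ k / measure \<mu> (E k)) powr (1 / p) \<le> \<phi> x"
proof -
  obtain b where b: "b \<in> borel_measurable \<mu>" "\<And>x. 0 \<le> b x"
    "\<And>k x. x \<in> E k \<Longrightarrow> (1/2) ^ k / measure \<mu> (E k) \<le> b x"
    "(\<integral>\<^sup>+ x. ennreal (b x) \<partial>\<mu>) < \<infinity>"
    using geometric_bump[of E \<mu>] assms(3,4) by blast
  have \<omega>: "\<omega> \<in> borel_measurable \<mu>" "\<And>x. 0 < \<omega> x"
    using assms(2) by (auto simp: weight_def)
  show ?thesis
  proof
    have "norm (complex_of_real (b x powr (1 / p) / \<omega> x) * complex_of_real (\<omega> x)) powr p = b x" for x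
    proof -
      have "complex_of_real (b x powr (1 / p) / \<omega> x) * complex_of_real (\<omega> x)
          = complex_of_real (b x powr (1 / p))"
        using \<omega>(2)[of x] by (simp add: less_imp_neq[symmetric])
      then show ?thesis
        using b(2)[of x] assms(1) by (simp add: powr_powr)
    qed
    moreover have "(\<lambda>x. complex_of_real (b x powr (1 / p) / \<omega> x)) \<in> borel_measurable \<mu>"
      using b(1) \<omega>(1) by measurable
    ultimately show "(\<lambda>x. complex_of_real (b x powr (1 / p) / \<omega> x)) \<in> weighted_Lp \<mu> p \<omega>"
      using b(4) by (simp add: weighted_Lp_def)
    show "((1/2) ^ k / measure \<mu> (E k)) powr (1 / p) \<le> b x powr (1 / p)" if "x \<in> E k" for k x
      using b(3)[OF that] assms(1) by (intro powr_mono2) auto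
  qed simp
qed

text \<open>Submultiplicativity gives \<open>\<omega> (- y + x) \<le> \<omega> (- y) * \<omega> x\<close>, so diagonal boundedness makes
  \<open>\<omega> x\<close> comparable from below with \<open>\<omega> y * \<omega> (- y + x)\<close>. The weights therefore cancel.\<close>

lemma convolution_lower_bound:
  fixes \<mu> :: "'a::group_add measure"
  assumes "weight \<mu> \<omega>" and "0 < M" and "\<And>x. \<omega> x * \<omega> (- x) < M"
    and "A \<in> fmeasurable \<mu>"
    and "\<And>x. 0 \<le> \<phi> x" and "\<And>x. 0 \<le> \<psi> x"
    and "0 \<le> \<alpha>" and "\<And>y. y \<in> A \<Longrightarrow> \<alpha> \<le> \<phi> y"
    and "0 \<le> \<beta>" and "\<And>y. y \<in> A \<Longrightarrow> \<beta> \<le> \<psi> (- y + x)"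
    and "integrable \<mu> (\<lambda>y. complex_of_real (\<phi> y / \<omega> y) * complex_of_real (\<psi> (- y + x) / \<omega> (- y + x)))"
  shows "\<alpha> * \<beta> * measure \<mu> A / M
    \<le> norm (convolution \<mu> (\<lambda>y. complex_of_real (\<phi> y / \<omega> y)) (\<lambda>y. complex_of_real (\<psi> y / \<omega> y)) x
        * complex_of_real (\<omega> x))"
proof -
  have \<omega>_pos: "0 < \<omega> y" and \<omega>_mult: "\<omega> (y + z) \<le> \<omega> y * \<omega> z" for y z
    using assms(1) by (auto simp: weight_def)
  let ?F = "\<lambda>y. \<phi> y / \<omega> y * (\<psi> (- y + x) / \<omega> (- y + x))"
  have int: "integrable \<mu> ?F"
    using integrable_Re[OF assms(11)] by simp
  have F0: "0 \<le> ?F y" for y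
    using assms(5)[of y] assms(6)[of "- y + x"] \<omega>_pos[of y] \<omega>_pos[of "- y + x"] by simp
  have lower: "\<alpha> * \<beta> / (M * \<omega> x) * indicat_real A y \<le> ?F y" for y
  proof (cases "y \<in> A")
    case True
    have "\<omega> y * \<omega> (- y + x) \<le> \<omega> y * (\<omega> (- y) * \<omega> x)"
      using \<omega>_mult \<omega>_pos[of y] by (intro mult_left_mono) auto
    also have "\<dots> = (\<omega> y * \<omega> (- y)) * \<omega> x"
      by simp
    also have "\<dots> \<le> M * \<omega> x"
      using assms(3)[of y] \<omega>_pos[of x] by (intro mult_right_mono) auto
    finally have le: "\<omega> y * \<omega> (- y + x) \<le> M * \<omega> x" .
    have "\<alpha> * \<beta> / (M * \<omega> x) \<le> \<phi> y * \<psi> (- y + x) / (\<omega> y * \<omega> (- y + x))"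
      using assms(5-10) True le \<omega>_pos by (intro frac_le[OF _ _ _ le] mult_mono mult_pos_pos mult_nonneg_nonneg) auto
    then show ?thesis
      using True by simp
  qed (use F0 in auto)
  have "\<alpha> * \<beta> / (M * \<omega> x) * measure \<mu> A = (\<integral> y. \<alpha> * \<beta> / (M * \<omega> x) * indicat_real A y \<partial>\<mu>)"
    using assms(4) by (simp add: fmeasurable_def)
  also have "\<dots> \<le> (\<integral> y. ?F y \<partial>\<mu>)"
    using assms(4) lower int
    by (intro integral_mono) (auto simp: fmeasurable_def integrable_indicator_iff)
  \<comment> \<open>Multiplying by \<omega> x removes the last weight, so the lower bound no longer
    depends on \<open>x\<close>.\<close>
  finally have "\<alpha> * \<beta> / (M * \<omega> x) * measure \<mu> A * \<omega> x \<le> (\<integral> y. ?F y \<partial>\<mu>) * \<omega> x"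
    using \<omega>_pos[of x] by (intro mult_right_mono) auto
  moreover have "\<alpha> * \<beta> / (M * \<omega> x) * measure \<mu> A * \<omega> x = \<alpha> * \<beta> * measure \<mu> A / M"
    using \<omega>_pos[of x] by simp
  moreover have "convolution \<mu> (\<lambda>y. complex_of_real (\<phi> y / \<omega> y)) (\<lambda>y. complex_of_real (\<psi> y / \<omega> y)) x
      = complex_of_real (\<integral> y. ?F y \<partial>\<mu>)"
    unfolding convolution_def by (simp flip: of_real_mult of_real_divide)
  moreover have "norm (complex_of_real (\<integral> y. ?F y \<partial>\<mu>) * complex_of_real (\<omega> x)) = (\<integral> y. ?F y \<partial>\<mu>) * \<omega> x"
    using F0 \<omega>_pos[of x] by (simp add: norm_mult integral_nonneg)
  ultimately show ?thesis by simp
qed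

text \<open>One pair of functions contains bumps for all scales k at once. On \<open>D k\<close> the
  weighted convolution has a constant lower bound, and integrating its p-th power over
  \<open>D k\<close> alone gives at least 2^k / (2 M^p). As this holds for each k, the norm cannot
  be finite.\<close>

lemma not_closed_under_convolution:
  fixes \<mu> :: "'a::group_add measure"
  assumes "1 < p" and "weight \<mu> \<omega>" and "diagonally_bounded \<omega>"
    and large: "\<And>t. \<exists>A B D. A \<in> fmeasurable \<mu> \<and> B \<in> fmeasurable \<mu> \<and> D \<in> fmeasurable \<mu> \<and>
      t \<le> measure \<mu> A \<and> t \<le> measure \<mu> B \<and> measure \<mu> B \<le> 2 * measure \<mu> D \<and>
      (\<forall>y\<in>A. \<forall>x\<in>D. - y + x \<in> B)"
  shows "\<not> closed_under_convolution \<mu> (weighted_Lp \<mu> p \<omega>)"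
proof
  assume closed: "closed_under_convolution \<mu> (weighted_Lp \<mu> p \<omega>)"
  obtain M where M: "0 < M" "\<And>x. \<omega> x * \<omega> (- x) < M"
    using assms(3) by (auto simp: diagonally_bounded_def)
  \<comment> \<open>The threshold makes t^(p-1) equal to 8^k. The factors 2^(-k) in the two bumps
    cost 4^(-k), which leaves 2^k.\<close>
  define t where "t k = (8 ^ k) powr (1 / (p - 1))" for k :: nat
  have t1: "1 \<le> t k" for k
    using assms(1) by (simp add: t_def ge_one_powr_ge_zero)
  have "\<exists>A B D. A \<in> fmeasurable \<mu> \<and> B \<in> fmeasurable \<mu> \<and> D \<in> fmeasurable \<mu> \<and>
      t k \<le> measure \<mu> A \<and> t k \<le> measure \<mu> B \<and> measure \<mu> B \<le> 2 * measure \<mu> D \<and>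
      (\<forall>y\<in>A. \<forall>x\<in>D. - y + x \<in> B)" for k
    by (rule large)
  then obtain A B D where
    fm: "\<And>k. A k \<in> fmeasurable \<mu>" "\<And>k. B k \<in> fmeasurable \<mu>" "\<And>k. D k \<in> fmeasurable \<mu>" and
    t: "\<And>k. t k \<le> measure \<mu> (A k)" "\<And>k. t k \<le> measure \<mu> (B k)" and
    BD: "\<And>k. measure \<mu> (B k) \<le> 2 * measure \<mu> (D k)" and
    ADB: "\<And>k x y. y \<in> A k \<Longrightarrow> x \<in> D k \<Longrightarrow> - y + x \<in> B k"
    by metis
  have ge1: "1 \<le> measure \<mu> (A k)" "1 \<le> measure \<mu> (B k)" for k
    using t1[of k] t[of k] by linarith+
  let ?lift = "\<lambda>\<phi> x. complex_of_real (\<phi> x / \<omega> x)"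
  let ?\<alpha> = "\<lambda>k. ((1/2) ^ k / measure \<mu> (A k)) powr (1 / p)"
  let ?\<beta> = "\<lambda>k. ((1/2) ^ k / measure \<mu> (B k)) powr (1 / p)"
  obtain \<phi> where \<phi>: "?lift \<phi> \<in> weighted_Lp \<mu> p \<omega>" "\<And>x. 0 \<le> \<phi> x" "\<And>k x. x \<in> A k \<Longrightarrow> ?\<alpha> k \<le> \<phi> x"
    using weighted_Lp_bump[of p \<mu> \<omega> A] assms(1,2) fm(1) ge1(1) by blast
  obtain \<psi> where \<psi>: "?lift \<psi> \<in> weighted_Lp \<mu> p \<omega>" "\<And>x. 0 \<le> \<psi> x" "\<And>k x. x \<in> B k \<Longrightarrow> ?\<beta> k \<le> \<psi> x"
    using weighted_Lp_bump[of p \<mu> \<omega> B] assms(1,2) fm(2) ge1(2) by blast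
  obtain h where h: "h \<in> weighted_Lp \<mu> p \<omega>" "AE x in \<mu>. convolution \<mu> (?lift \<phi>) (?lift \<psi>) x = h x"
    and int: "AE x in \<mu>. integrable \<mu> (\<lambda>y. ?lift \<phi> y * ?lift \<psi> (- y + x))"
    using closed \<phi>(1) \<psi>(1) unfolding closed_under_convolution_def by meson
  let ?I = "\<integral>\<^sup>+ x. ennreal (norm (h x * complex_of_real (\<omega> x)) powr p) \<partial>\<mu>"
  have "ennreal (2 ^ k / (2 * M powr p)) \<le> ?I" for k
  proof -
    let ?c = "(?\<alpha> k * ?\<beta> k * measure \<mu> (A k) / M) powr p"
    have "AE x in \<mu>. ennreal ?c * indicator (D k) x
        \<le> ennreal (norm (h x * complex_of_real (\<omega> x)) powr p)"
      using h(2) int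
    proof eventually_elim
      case (elim x)
      show ?case
      proof (cases "x \<in> D k")
        case True
        have "?\<alpha> k * ?\<beta> k * measure \<mu> (A k) / M
            \<le> norm (convolution \<mu> (?lift \<phi>) (?lift \<psi>) x * complex_of_real (\<omega> x))"
          using True elim(2) by (intro convolution_lower_bound assms(2) M fm \<phi> \<psi> ADB) auto
        then have "?c \<le> norm (h x * complex_of_real (\<omega> x)) powr p"
          using elim(1) assms(1) M(1) by (intro powr_mono2) auto
        then show ?thesis
          using True by (simp add: ennreal_leI)
      qed simp
    qed
    then have "(\<integral>\<^sup>+ x. ennreal ?c * indicator (D k) x \<partial>\<mu>) \<le> ?I"
      by (rule nn_integral_mono_AE)
    moreover have "(\<integral>\<^sup>+ x. ennreal ?c * indicator (D k) x \<partial>\<mu>) = ennreal (?c * measure \<mu> (D k))"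
      using fm(3)[of k]
      by (subst nn_integral_cmult_indicator, simp add: fmeasurable_def, subst ennreal_mult)
        (simp_all add: emeasure_eq_measure2)
    moreover have "2 ^ k / (2 * M powr p) \<le> ?c * measure \<mu> (D k)"
    proof -
      let ?a = "measure \<mu> (A k)" and ?b = "measure \<mu> (B k)" and ?d = "measure \<mu> (D k)"
      have a: "0 < ?a" and b: "0 < ?b"
        using ge1[of k] by linarith+
      have "8 ^ k = t k powr (p - 1)"
        using assms(1) by (simp add: t_def powr_powr)
      also have "\<dots> \<le> ?a powr (p - 1)"
        using t(1)[of k] t1[of k] assms(1) by (intro powr_mono2) auto
      finally have a8: "8 ^ k \<le> ?a powr (p - 1)" .
      have \<alpha>\<beta>: "?\<alpha> k powr p = (1/2) ^ k / ?a" "?\<beta> k powr p = (1/2) ^ k / ?b"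
        using assms(1) a b by (simp_all add: powr_powr)
      \<comment> \<open>The measure of \<open>A k\<close> enters with exponent p from the
        convolution and -1 from its bump, hence p - 1 in total. The factor 1 / ?b from the other
        bump is offset by ?d up to a factor 2.\<close>
      have "?c = ?\<alpha> k powr p * ?\<beta> k powr p * ?a powr p / M powr p"
        using a M(1) by (simp add: powr_divide powr_mult)
      also have "\<dots> = (1/4) ^ k * ?a powr (p - 1) / ?b / M powr p"
      proof -
        have "?a powr p = ?a powr (p - 1) * ?a"
          using a by (simp add: powr_diff)
        moreover have "(1/4 :: real) ^ k = (1/2) ^ k * (1/2) ^ k"
          by (simp flip: power_mult_distrib)
        ultimately show ?thesis
          unfolding \<alpha>\<beta> using a by simp
      qed
      finally have c: "?c * ?d = (1/4) ^ k * ?a powr (p - 1) * (?d / ?b) / M powr p"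
        by simp
      have "(1/4) ^ k * 8 ^ k * (1/2) / M powr p \<le> ?c * ?d"
        unfolding c using a8 BD[of k] b
        by (intro divide_right_mono mult_mono) (auto simp: field_simps)
      moreover have "(1/4) ^ k * 8 ^ k = (2 :: real) ^ k"
        by (simp flip: power_mult_distrib)
      ultimately show ?thesis by (simp add: field_simps)
    qed
    ultimately show ?thesis
      by (simp only: order_trans[OF ennreal_leI])
  qed
  moreover have "?I < \<infinity>"
    using h(1) by (simp add: weighted_Lp_def)
  then obtain r where r: "0 \<le> r" "?I = ennreal r"
    by (cases ?I) auto
  ultimately have le: "2 ^ k / (2 * M powr p) \<le> r" for k
    by simp
  obtain k where "r * (2 * M powr p) < 2 ^ k"
    using real_arch_pow[of 2] by auto
  with le[of k] M(1) show False
    by (simp add: field_simps)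
qed

theorem theorem9:
  fixes \<mu> :: "'a::{topological_group_add, t2_space} measure"
    and \<omega> :: "'a \<Rightarrow> real"
    and p :: real
  assumes "locally_compact_space (euclidean :: 'a topology)"
    and "nilpotent_group TYPE('a)"
    and "left_haar_measure \<mu>"
    and "1 < p"
    and "weight \<mu> \<omega>"
    and "diagonally_bounded \<omega>"
    and "closed_under_convolution \<mu> (weighted_Lp \<mu> p \<omega>)"
  shows "compact (UNIV :: 'a set)"
proof (rule ccontr)
  assume noncompact: "\<not> compact (UNIV :: 'a set)"
  \<comment> \<open>Witnesses are \<open>V\<close> and its powers with n + 2 and n + 1 factors.
    Symmetry of \<open>V\<close> puts - y + x into the larger power, and since the identity is in
    \<open>V\<close> that power contains \<open>V\<close>, so it is also large.\<close>
  have "\<exists>A B D. A \<in> fmeasurable \<mu> \<and> B \<in> fmeasurable \<mu> \<and> D \<in> fmeasurable \<mu> \<and>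
      t \<le> measure \<mu> A \<and> t \<le> measure \<mu> B \<and> measure \<mu> B \<le> 2 * measure \<mu> D \<and>
      (\<forall>y\<in>A. \<forall>x\<in>D. - y + x \<in> B)" for t
  proof -
    obtain V where V: "compact V" "0 \<in> interior V" "uminus ` V = V" "t \<le> measure \<mu> V"
      using haar_large_compact[OF assms(3,1) noncompact] .
    obtain n where n: "measure \<mu> (set_power V (Suc (Suc n))) \<le> 2 * measure \<mu> (set_power V (Suc n))"
      using haar_power_doubling[OF assms(3,2) V(1,2)] .
    note fm = haar_fmeasurable_compact[OF assms(3) compact_set_power[OF V(1)]]
    have V1: "set_power V (Suc 0) = V"
      by simp
    have "set_power V (Suc 0) \<subseteq> set_power V (Suc (Suc n))"
      using V(2) interior_subset[of V] by (intro set_power_mono_exponent) auto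
    then have "measure \<mu> V \<le> measure \<mu> (set_power V (Suc (Suc n)))"
      unfolding V1
      using haar_sets_compact[OF assms(3) V(1)] by (intro measure_mono_fmeasurable fm)
    moreover have "- y + x \<in> set_power V (Suc (Suc n))"
      if "y \<in> V" "x \<in> set_power V (Suc n)" for x y
    proof -
      have "- y \<in> set_power V (Suc 0)"
        unfolding V1 using V(3) that(1) by blast
      from set_power_add[OF this that(2)] show ?thesis
        by (simp only: add_Suc add_0)
    qed
    ultimately show ?thesis
      using fm[of "Suc 0"] fm V(4) n unfolding V1
      by (intro exI[of _ V] exI[of _ "set_power V (Suc (Suc n))"] exI[of _ "set_power V (Suc n)"])
        (auto simp del: set_power.simps)
  qed
  then show False
    using not_closed_under_convolution[OF assms(4-6)] assms(7) by blast
qed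

end
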